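(* Let $m>0$, $n_{\rm el}>0$, $a_{\rm B}>0$, and $\eta>0$ with $\eta\ne1$, and consider the Coulomb interaction $\tilde v(\mathbf q)=\dfrac{2\pi}{m a_{\rm B}|\mathbf q|}$. Let $E^{\rm pVP}[\zeta]/A$ and $E^{\rm pSP}[\zeta]/A$ be the RPA energies per unit area (kinetic plus exchange plus ring) of the partially valley-polarized and partially spin-polarized states with polarization $\zeta$. Assume that both are twice differentiable at $\zeta=0$, with vanishing first derivative and positive second derivative there (the symmetric state is a local minimum), and define the valley and spin susceptibilities by $$\chi_{\rm v}^{-1}=\frac1A\frac{\partial^2E^{\rm pVP}[\zeta]}{\partial\zeta^2}\Big|_{\zeta=0},\qquad \chi_{\rm s}^{-1}=\frac1A\frac{\partial^2E^{\rm pSP}[\zeta]}{\partial\zeta^2}\Big|_{\zeta=0}.$$ Then $\chi_{\rm s}\le\chi_{\rm v}$.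
   Context: Units with $\hbar=1$. There are four electron flavors $\alpha=1,2,3,4$, standing for (spin, valley) $=(\uparrow,X),(\downarrow,X),(\uparrow,Y),(\downarrow,Y)$, with mass anisotropies $\eta_1=\eta_2=\eta$, $\eta_3=\eta_4=1/\eta$, and dispersions $\epsilon_\alpha(\mathbf q)=\dfrac{q_x^2/\sqrt{\eta_\alpha}+q_y^2\sqrt{\eta_\alpha}}{2m}$. The flavor densities are $n_\alpha=\nu_\alpha n_{\rm el}$ with $\nu_\alpha\ge0$, $\sum_\alpha\nu_\alpha=1$. The RPA energy per unit area of the state with filling fractions $\nu_\alpha$ is $E/A=E_0/A+E_{\rm x}/A+E_{\rm r}/A$, where the kinetic and exchange energies are $$\frac{E_0}{A}=\frac{\pi n_{\rm el}^2}{m}\sum_\alpha\nu_\alpha^2,\qquad \frac{E_{\rm x}}{A}=-\frac{8\mathscr K(\eta)}{3\pi}\,\frac{\sqrt{\pi}\,n_{\rm el}^{3/2}}{m a_{\rm B}}\sum_\alpha\nu_\alpha^{3/2},\qquad \mathscr K(\eta)=\int_0^{2\pi}\frac{d\theta}{2\pi}\frac{1}{\sqrt{\sqrt\eta\cos^2\theta+\sin^2\theta/\sqrt\eta}},$$ and the ring (RPA correlation) energy is $$\frac{E_{\rm r}}{A}=\int_0^\infty\frac{d\Omega}{2\pi}\int_{\mathbb{R}^2}\frac{d^2\mathbf q}{(2\pi)^2}\Big\{\log\big[1+\tilde v(\mathbf q)\Pi(i\Omega,\mathbf q)\big]-\tilde v(\mathbf q)\Pi(i\Omega,\mathbf q)\Big\},$$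 with the Lindhard function $$\Pi(i\Omega,\mathbf q)=\frac{m}{2\pi}\sum_{\alpha=1}^4\left(1-\operatorname{Re}\sqrt{\Big(1+\frac{i\Omega}{\epsilon_\alpha(\mathbf q)}\Big)^2-\frac{8\pi n_\alpha}{m\,\epsilon_\alpha(\mathbf q)}}\right)$$ (principal square root). $E^{\rm pVP}[\zeta]$ is the energy for $(\nu_1,\nu_2,\nu_3,\nu_4)=\big(\tfrac{1+\zeta}{4},\tfrac{1+\zeta}{4},\tfrac{1-\zeta}{4},\tfrac{1-\zeta}{4}\big)$, and $E^{\rm pSP}[\zeta]$ is the energy for $(\nu_1,\nu_2,\nu_3,\nu_4)=\big(\tfrac{1+\zeta}{4},\tfrac{1-\zeta}{4},\tfrac{1+\zeta}{4},\tfrac{1-\zeta}{4}\big)$, $\zeta\in[-1,1]$. *)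

theory Defs
  imports "HOL-Analysis.Analysis"
begin

text \<open>Units with \<open>\<hbar> = 1\<close>. Flavors are indexed by \<open>1..4\<close>, standing for
  (spin, valley) = (up, X), (down, X), (up, Y), (down, Y). All energies below are energies per
  unit area. Points \<open>q\<close> of the momentum plane are pairs of reals, whose norm is the Euclidean one.
  A state is given by its filling fractions \<open>\<nu>\<close>; the flavor densities are
  \<open>\<nu> \<alpha> * n\<close>, where \<open>n\<close> is the total electron density.\<close>

definition anisotropy :: "real \<Rightarrow> nat \<Rightarrow> real" where
  "anisotropy \<eta> \<alpha> = (if \<alpha> \<in> {1, 2} then \<eta> else 1 / \<eta>)"

definition dispersion :: "real \<Rightarrow> real \<Rightarrow> nat \<Rightarrow> real \<times> real \<Rightarrow> real" where
  "dispersion m \<eta> \<alpha> q =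
     ((fst q)\<^sup>2 / sqrt (anisotropy \<eta> \<alpha>) + (snd q)\<^sup>2 * sqrt (anisotropy \<eta> \<alpha>)) / (2 * m)"

definition coulomb :: "real \<Rightarrow> real \<Rightarrow> real \<times> real \<Rightarrow> real" where
  "coulomb m a\<^sub>B q = 2 * pi / (m * a\<^sub>B * norm q)"

definition kinetic_energy :: "real \<Rightarrow> real \<Rightarrow> (nat \<Rightarrow> real) \<Rightarrow> real" where
  "kinetic_energy m n \<nu> = pi * n\<^sup>2 / m * (\<Sum>\<alpha>=1..4. (\<nu> \<alpha>)\<^sup>2)"

definition exchange_factor :: "real \<Rightarrow> real" where
  "exchange_factor \<eta> =
     (LBINT \<theta>:{0..2 * pi}. 1 / sqrt (sqrt \<eta> * (cos \<theta>)\<^sup>2 + (sin \<theta>)\<^sup>2 / sqrt \<eta>) / (2 * pi))"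

definition exchange_energy :: "real \<Rightarrow> real \<Rightarrow> real \<Rightarrow> real \<Rightarrow> (nat \<Rightarrow> real) \<Rightarrow> real" where
  "exchange_energy m n a\<^sub>B \<eta> \<nu> =
     - (8 * exchange_factor \<eta> / (3 * pi)) * (sqrt pi * n powr (3 / 2) / (m * a\<^sub>B))
       * (\<Sum>\<alpha>=1..4. \<nu> \<alpha> powr (3 / 2))"

text \<open>The Lindhard function at imaginary frequency \<open>\<i> * \<Omega>\<close>; \<^const>\<open>csqrt\<close> is the principal
  branch.\<close>

definition lindhard ::
    "real \<Rightarrow> real \<Rightarrow> real \<Rightarrow> (nat \<Rightarrow> real) \<Rightarrow> real \<Rightarrow> real \<times> real \<Rightarrow> real" where
  "lindhard m n \<eta> \<nu> \<Omega> q =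
     m / (2 * pi) * (\<Sum>\<alpha>=1..4.
       1 - Re (csqrt ((1 + \<i> * complex_of_real (\<Omega> / dispersion m \<eta> \<alpha> q))\<^sup>2
                - complex_of_real (8 * pi * (\<nu> \<alpha> * n) / (m * dispersion m \<eta> \<alpha> q)))))"

definition ring_energy ::
    "(real \<times> real \<Rightarrow> real) \<Rightarrow> real \<Rightarrow> real \<Rightarrow> real \<Rightarrow> (nat \<Rightarrow> real) \<Rightarrow> real" where
  "ring_energy v m n \<eta> \<nu> =
     (LBINT \<Omega>:{0..}. (LINT q|lborel.
        (ln (1 + v q * lindhard m n \<eta> \<nu> \<Omega> q) - v q * lindhard m n \<eta> \<nu> \<Omega> q)
        / (2 * pi)\<^sup>2) / (2 * pi))"

definition rpa_energy :: "real \<Rightarrow> real \<Rightarrow> real \<Rightarrow> real \<Rightarrow> (nat \<Rightarrow> real) \<Rightarrow> real" where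
  "rpa_energy m n a\<^sub>B \<eta> \<nu> =
     kinetic_energy m n \<nu> + exchange_energy m n a\<^sub>B \<eta> \<nu>
     + ring_energy (coulomb m a\<^sub>B) m n \<eta> \<nu>"

definition pVP_filling :: "real \<Rightarrow> nat \<Rightarrow> real" where
  "pVP_filling \<zeta> \<alpha> = (if \<alpha> \<in> {1, 2} then (1 + \<zeta>) / 4 else (1 - \<zeta>) / 4)"

definition pSP_filling :: "real \<Rightarrow> nat \<Rightarrow> real" where
  "pSP_filling \<zeta> \<alpha> = (if \<alpha> \<in> {1, 3} then (1 + \<zeta>) / 4 else (1 - \<zeta>) / 4)"

text \<open>The polarization \<open>\<zeta>\<close> is only meaningful in \<open>[-1, 1]\<close>. The functions are total, but only
  their germs at \<open>\<zeta> = 0\<close> are used.\<close>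

definition E_pVP :: "real \<Rightarrow> real \<Rightarrow> real \<Rightarrow> real \<Rightarrow> real \<Rightarrow> real" where
  "E_pVP m n a\<^sub>B \<eta> \<zeta> = rpa_energy m n a\<^sub>B \<eta> (pVP_filling \<zeta>)"

definition E_pSP :: "real \<Rightarrow> real \<Rightarrow> real \<Rightarrow> real \<Rightarrow> real \<Rightarrow> real" where
  "E_pSP m n a\<^sub>B \<eta> \<zeta> = rpa_energy m n a\<^sub>B \<eta> (pSP_filling \<zeta>)"

definition twice_differentiable_at :: "(real \<Rightarrow> real) \<Rightarrow> real \<Rightarrow> bool" where
  "twice_differentiable_at f x \<longleftrightarrow>
     (\<forall>\<^sub>F y in nhds x. f differentiable (at y)) \<and> deriv f differentiable (at x)"

definition chi_v :: "real \<Rightarrow> real \<Rightarrow> real \<Rightarrow> real \<Rightarrow> real" where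
  "chi_v m n a\<^sub>B \<eta> = inverse (deriv (deriv (E_pVP m n a\<^sub>B \<eta>)) 0)"

definition chi_s :: "real \<Rightarrow> real \<Rightarrow> real \<Rightarrow> real \<Rightarrow> real" where
  "chi_s m n a\<^sub>B \<eta> = inverse (deriv (deriv (E_pSP m n a\<^sub>B \<eta>)) 0)"

end

theory Submission
  imports Defs
begin

text \<open>At every frequency and momentum, the Lindhard function of the spin-polarized state is the
  average of those of the valley-polarized states with polarization \<open>\<zeta>\<close> and \<open>-\<zeta>\<close>, and the
  latter two differ only by exchanging the momentum components. As \<open>x \<mapsto> ln (1 + x) - x\<close> is
  concave, the energy of the spin-polarized state is at least that of the valley-polarized one;
  the two agree at \<open>\<zeta> = 0\<close>, so the second derivatives there are ordered in the same way.

  The integrals are \<open>0\<close> where the integrand is not integrable. Convergence need not be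
  established: \<open>h x = x - ln (1 + x)\<close> satisfies \<open>h (2 * x) \<le> 4 * h x\<close>, so that the
  integrands of the two states dominate each other up to constants, and the integrals converge or
  diverge together.\<close>

section \<open>The integrand of the ring energy\<close>

lemma ln_defect_nonneg:
  fixes x :: real
  assumes "0 \<le> x"
  shows "0 \<le> x - ln (1 + x)"
  using ln_add_one_self_le_self[OF assms] by simp

lemma ln_defect_mono:
  fixes x y :: real
  assumes "0 \<le> x" "x \<le> y"
  shows "x - ln (1 + x) \<le> y - ln (1 + y)"
proof -
  have "ln ((1 + y) / (1 + x)) \<le> (1 + y) / (1 + x) - 1"
    using assms by (intro ln_le_minus_one) auto
  also have "\<dots> = (y - x) / (1 + x)"
    using assms by (simp add: field_simps)
  also have "\<dots> \<le> (y - x) / 1"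
    using assms by (intro divide_left_mono) auto
  finally show ?thesis
    using assms by (simp add: ln_div)
qed

text \<open>The difference of the two sides vanishes at 0 and has derivative
  \<open>4 * t^2 / ((1 + t) * (1 + 2 * t))\<close>. Since \<open>x - ln (1 + x)\<close> behaves like
  \<open>x^2 / 2\<close> near 0, no constant below 4 would do.\<close>

lemma ln_defect_double:
  fixes x :: real
  assumes "0 \<le> x"
  shows "2 * x - ln (1 + 2 * x) \<le> 4 * (x - ln (1 + x))"
proof -
  let ?f = "\<lambda>x::real. 4 * (x - ln (1 + x)) - (2 * x - ln (1 + 2 * x))"
  have "?f 0 \<le> ?f x"
  proof (rule DERIV_nonneg_imp_nondecreasing[OF assms])
    fix t :: real
    assume t: "0 \<le> t"
    have "(?f has_real_derivative 4 * (1 - 1 / (1 + t)) - (2 - 2 / (1 + 2 * t))) (at t)"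
      using t by (auto intro!: derivative_eq_intros simp: field_simps)
    moreover have "4 * (1 - 1 / (1 + t)) - (2 - 2 / (1 + 2 * t))
        = 4 * t\<^sup>2 / ((1 + t) * (1 + 2 * t))"
      using t by (simp add: divide_simps add_eq_0_iff) (simp add: algebra_simps power2_eq_square)
    moreover have "0 \<le> 4 * t\<^sup>2 / ((1 + t) * (1 + 2 * t))"
      using t by simp
    ultimately show "\<exists>y. (?f has_real_derivative y) (at t) \<and> 0 \<le> y"
      by metis
  qed
  then show ?thesis by simp
qed

text \<open>The linear parts cancel; what remains is the logarithm of the AM-GM inequality for
  \<open>1 + x\<close> and \<open>1 + y\<close>.\<close>

lemma ln_defect_midpoint:
  fixes x y :: real
  assumes "0 \<le> x" "0 \<le> y"
  shows "(x + y) / 2 - ln (1 + (x + y) / 2) \<le> ((x - ln (1 + x)) + (y - ln (1 + y))) / 2"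
proof -
  have "(1 + x) * (1 + y) \<le> (1 + (x + y) / 2)\<^sup>2"
    using zero_le_power2[of "x - y"] by (simp add: power2_eq_square algebra_simps)
  then have "ln ((1 + x) * (1 + y)) \<le> ln ((1 + (x + y) / 2)\<^sup>2)"
    using assms by (intro ln_mono) auto
  then have "ln (1 + x) + ln (1 + y) \<le> 2 * ln (1 + (x + y) / 2)"
    using assms by (simp add: ln_mult ln_realpow)
  then show ?thesis by (simp add: field_simps)
qed

section \<open>Comparison of iterated integrals\<close>

lemma integrable_nonneg_dominated:
  fixes f g :: "'a \<Rightarrow> real"
  assumes "integrable M g" "f \<in> borel_measurable M"
    and "\<And>x. x \<in> space M \<Longrightarrow> 0 \<le> f x" "\<And>x. x \<in> space M \<Longrightarrow> f x \<le> g x"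
  shows "integrable M f"
  using assms(1,2) by (rule Bochner_Integration.integrable_bound)
    (auto simp: assms(3) intro!: AE_I2 order_trans[OF assms(4)])

text \<open>As \<open>T\<close> preserves \<open>M\<close>, the average of \<open>g\<close> and its
  composite with \<open>T\<close> has the same integral as \<open>g\<close>. The bound
  \<open>fg\<close> carries integrability from \<open>g\<close> to \<open>f\<close>, and
  \<open>gf\<close> carries it back; if both fail, both integrals are 0. The second conclusion has
  the form of \<open>gf\<close> again, which lets the lemma be applied to integrals of
  integrals.\<close>

lemma integral_mono_symmetrized:
  fixes f g :: "'a \<Rightarrow> real"
  assumes f [measurable]: "f \<in> borel_measurable M" and g [measurable]: "g \<in> borel_measurable M"
    and T [measurable]: "T \<in> measurable M M" and dist: "distr M M T = M"
    and f0: "\<And>x. x \<in> space M \<Longrightarrow> 0 \<le> f x" and g0: "\<And>x. x \<in> space M \<Longrightarrow> 0 \<le> g x"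
    and fg: "\<And>x. x \<in> space M \<Longrightarrow> f x \<le> (g x + g (T x)) / 2"
    and gf: "\<And>x. x \<in> space M \<Longrightarrow> g x \<le> c * f x"
  shows "(\<integral>x. f x \<partial>M) \<le> (\<integral>x. g x \<partial>M)" and "(\<integral>x. g x \<partial>M) \<le> c * (\<integral>x. f x \<partial>M)"
proof -
  have gT: "integrable M (\<lambda>x. g (T x)) \<longleftrightarrow> integrable M g"
    "(\<integral>x. g (T x) \<partial>M) = (\<integral>x. g x \<partial>M)"
    using integrable_distr_eq[OF T, of g] integral_distr[OF T, of g] by (auto simp: dist)
  have "(\<integral>x. f x \<partial>M) \<le> (\<integral>x. g x \<partial>M) \<and> (\<integral>x. g x \<partial>M) \<le> c * (\<integral>x. f x \<partial>M)"
  proof (cases "integrable M g")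
    case True
    have avg: "integrable M (\<lambda>x. (g x + g (T x)) / 2)"
      using True gT by auto
    have intf: "integrable M f"
      using avg f f0 fg by (rule integrable_nonneg_dominated)
    have "(\<integral>x. f x \<partial>M) \<le> (\<integral>x. (g x + g (T x)) / 2 \<partial>M)"
      using intf avg fg by (rule integral_mono)
    also have "\<dots> = (\<integral>x. g x \<partial>M)"
      using True gT by simp
    finally have "(\<integral>x. f x \<partial>M) \<le> (\<integral>x. g x \<partial>M)" .
    moreover have "(\<integral>x. g x \<partial>M) \<le> (\<integral>x. c * f x \<partial>M)"
      using True intf gf by (intro integral_mono) auto
    ultimately show ?thesis by simp
  next
    case False
    moreover have "\<not> integrable M f"
    proof
      assume "integrable M f"
      then have "integrable M (\<lambda>x. c * f x)" by simp
      then have "integrable M g"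
        using g g0 gf by (rule integrable_nonneg_dominated)
      with False show False ..
    qed
    ultimately show ?thesis by (simp add: not_integrable_integral_eq)
  qed
  then show "(\<integral>x. f x \<partial>M) \<le> (\<integral>x. g x \<partial>M)" "(\<integral>x. g x \<partial>M) \<le> c * (\<integral>x. f x \<partial>M)"
    by auto
qed

text \<open>The preceding lemma is used twice: on each section with \<open>T\<close>, then on the
  inner integrals. The inner inequalities hold for every \<open>x\<close>, also where a section is
  not integrable.\<close>

lemma iterated_integral_mono_symmetrized:
  fixes f g :: "'a \<Rightarrow> 'b \<Rightarrow> real"
  assumes N: "sigma_finite_measure N"
    and f [measurable]: "case_prod f \<in> borel_measurable (M \<Otimes>\<^sub>M N)"
    and g [measurable]: "case_prod g \<in> borel_measurable (M \<Otimes>\<^sub>M N)"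
    and T [measurable]: "T \<in> measurable N N" and dist: "distr N N T = N"
    and f0: "\<And>x y. 0 \<le> f x y" and g0: "\<And>x y. 0 \<le> g x y"
    and fg: "\<And>x y. f x y \<le> (g x y + g x (T y)) / 2"
    and gf: "\<And>x y. g x y \<le> c * f x y"
  shows "(\<integral>x. \<integral>y. f x y \<partial>N \<partial>M) \<le> (\<integral>x. \<integral>y. g x y \<partial>N \<partial>M)"
proof -
  interpret N: sigma_finite_measure N by fact
  have inner: "(\<integral>y. f x y \<partial>N) \<le> (\<integral>y. g x y \<partial>N)"
    "(\<integral>y. g x y \<partial>N) \<le> c * (\<integral>y. f x y \<partial>N)" if "x \<in> space M" for x
  proof -
    have [measurable]: "f x \<in> borel_measurable N" "g x \<in> borel_measurable N"
      using measurable_Pair2[OF f that] measurable_Pair2[OF g that] by simp_all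
    show "(\<integral>y. f x y \<partial>N) \<le> (\<integral>y. g x y \<partial>N)"
      "(\<integral>y. g x y \<partial>N) \<le> c * (\<integral>y. f x y \<partial>N)"
      by (rule integral_mono_symmetrized[where T = T and c = c]; use dist f0 g0 fg gf in simp)+
  qed
  have [measurable]: "(\<lambda>x. \<integral>y. f x y \<partial>N) \<in> borel_measurable M"
    "(\<lambda>x. \<integral>y. g x y \<partial>N) \<in> borel_measurable M"
    by measurable
  \<comment> \<open>The inner integrals are already ordered pointwise, so the identity serves as the
    symmetry.\<close>
  show ?thesis
    by (rule integral_mono_symmetrized(1)[where T = "\<lambda>x. x" and c = c])
      (use inner f0 g0 in \<open>auto simp: integral_nonneg_AE distr_id\<close>)
qed

lemma distr_lborel_swap:
  "distr lborel lborel (\<lambda>q::real \<times> real. (snd q, fst q)) = lborel"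
  using lborel_pair.distr_pair_swap[where 'a = real and 'b = real]
  by (simp add: lborel_prod case_prod_unfold)

section \<open>The Lindhard function\<close>

text \<open>The principal root of \<open>z\<close> has real part
  \<open>sqrt ((cmod z + Re z) / 2)\<close>. The bound on \<open>cmod z\<close> holds because the
  two squares compared differ by exactly \<open>4 * y\<close>.\<close>

lemma Re_csqrt_le_one:
  fixes x y :: real
  assumes "0 \<le> y"
  shows "Re (csqrt ((1 + \<i> * complex_of_real x)\<^sup>2 - complex_of_real y)) \<le> 1"
proof -
  let ?z = "(1 + \<i> * complex_of_real x)\<^sup>2 - complex_of_real y"
  have Re: "Re ?z = 1 - x\<^sup>2 - y" and Im: "Im ?z = 2 * x"
    by (simp_all add: power2_eq_square)
  have "(cmod ?z)\<^sup>2 = (1 - x\<^sup>2 - y)\<^sup>2 + (2 * x)\<^sup>2"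
    by (simp only: cmod_power2 Re Im)
  also have "\<dots> \<le> (1 + x\<^sup>2 + y)\<^sup>2"
    using assms by (simp add: power2_eq_square algebra_simps)
  finally have "cmod ?z \<le> 1 + x\<^sup>2 + y"
    by (rule power2_le_imp_le) (use assms in simp)
  then have "(cmod ?z + Re ?z) / 2 \<le> 1"
    unfolding Re by simp
  then show ?thesis
    by (simp only: csqrt.sel real_sqrt_le_1_iff)
qed

lemma dispersion_nonneg:
  assumes "0 < m" "0 < \<eta>"
  shows "0 \<le> dispersion m \<eta> \<alpha> q"
  using assms by (auto simp: dispersion_def anisotropy_def)

lemma lindhard_nonneg:
  assumes "0 < m" "0 \<le> n" "0 < \<eta>" "\<And>\<alpha>. 0 \<le> \<nu> \<alpha>"
  shows "0 \<le> lindhard m n \<eta> \<nu> \<Omega> q"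
proof -
  \<comment> \<open>This covers \<open>q = 0\<close> too: the dispersion vanishes there and the
    quotient is 0 by convention.\<close>
  have "0 \<le> 8 * pi * (\<nu> \<alpha> * n) / (m * dispersion m \<eta> \<alpha> q)" for \<alpha>
    using assms dispersion_nonneg[OF assms(1,3), of \<alpha> q] by simp
  then show ?thesis
    unfolding lindhard_def using assms(1)
    by (intro mult_nonneg_nonneg sum_nonneg)
      (simp_all add: Re_csqrt_le_one del: csqrt.sel of_real_divide of_real_mult)
qed

text \<open>The explicit formula for the real part avoids any discussion of the branch cut.\<close>

lemma borel_measurable_Re_csqrt [measurable (raw)]:
  assumes [measurable]: "f \<in> borel_measurable M"
  shows "(\<lambda>x. Re (csqrt (f x))) \<in> borel_measurable M"
  unfolding csqrt.sel by measurable

lemma borel_measurable_dispersion [measurable]: "dispersion m \<eta> \<alpha> \<in> borel_measurable borel"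
  unfolding dispersion_def divide_inverse
  by (intro borel_measurable_continuous_onI continuous_intros)

lemma borel_measurable_lindhard [measurable (raw)]:
  assumes [measurable]: "f \<in> borel_measurable M" "g \<in> borel_measurable M"
  shows "(\<lambda>x. lindhard m n \<eta> \<nu> (f x) (g x)) \<in> borel_measurable M"
  unfolding lindhard_def by measurable

lemma sum_flavors: "(\<Sum>\<alpha>=1..4. f \<alpha>) = f 1 + f 2 + f 3 + f (4::nat)" for f :: "nat \<Rightarrow> real"
  by (simp add: eval_nat_numeral atLeastAtMostSuc_conv algebra_simps)

text \<open>Inverting the anisotropy exchanges the roles of the two momentum components.\<close>

lemma dispersion_swap: "dispersion m \<eta> 3 q = dispersion m \<eta> 1 (snd q, fst q)"
  by (simp add: dispersion_def anisotropy_def real_sqrt_divide)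

lemma dispersion_valley:
  "dispersion m \<eta> 2 q = dispersion m \<eta> 1 q" "dispersion m \<eta> 4 q = dispersion m \<eta> 3 q"
  by (simp_all add: dispersion_def anisotropy_def)

text \<open>The spin-polarized state has one flavor for each pair of a valley and a filling
  \<open>(1 + \<zeta>) / 4\<close> or \<open>(1 - \<zeta>) / 4\<close>. The valley-polarized state
  has two of these four terms, each twice; swapping the components of \<open>q\<close> yields the
  other two.\<close>

lemma lindhard_pSP_eq_average:
  "lindhard m n \<eta> (pSP_filling \<zeta>) \<Omega> q
    = (lindhard m n \<eta> (pVP_filling \<zeta>) \<Omega> q
       + lindhard m n \<eta> (pVP_filling \<zeta>) \<Omega> (snd q, fst q)) / 2"
  unfolding lindhard_def sum_flavors dispersion_valley dispersion_swap
  by (simp add: pSP_filling_def pVP_filling_def algebra_simps add_divide_distrib del: csqrt.sel)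

section \<open>Comparison of the energies\<close>

text \<open>The sign is flipped to make the integrand nonnegative, and the frequency cutoff and all
  constants move inside. Scalars pass through the integral even where it diverges.\<close>

lemma ring_energy_eq_iterated_integral:
  "ring_energy v m n \<eta> \<nu> =
    - (\<integral>\<Omega>. \<integral>q. indicator {0..} \<Omega> / (2 * pi) ^ 3
        * (v q * lindhard m n \<eta> \<nu> \<Omega> q - ln (1 + v q * lindhard m n \<eta> \<nu> \<Omega> q)) \<partial>lborel \<partial>lborel)"
proof -
  have "(indicator {0..} \<Omega> :: real) *\<^sub>R ((LINT q|lborel.
          (ln (1 + v q * lindhard m n \<eta> \<nu> \<Omega> q) - v q * lindhard m n \<eta> \<nu> \<Omega> q)
          / (2 * pi)\<^sup>2) / (2 * pi))
    = - (\<integral>q. indicator {0..} \<Omega> / (2 * pi) ^ 3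
        * (v q * lindhard m n \<eta> \<nu> \<Omega> q - ln (1 + v q * lindhard m n \<eta> \<nu> \<Omega> q)) \<partial>lborel)" for \<Omega>
    unfolding integral_divide_zero[symmetric] integral_scaleR_right[symmetric]
      integral_minus[symmetric]
    by (rule Bochner_Integration.integral_cong)
      (simp_all add: field_simps power2_eq_square power3_eq_cube)
  then show ?thesis
    unfolding ring_energy_def set_lebesgue_integral_def by simp
qed

lemma ring_energy_pVP_le_pSP:
  assumes m: "0 < m" and n: "0 \<le> n" and \<eta>: "0 < \<eta>" and \<zeta>: "\<bar>\<zeta>\<bar> \<le> 1"
    and v [measurable]: "v \<in> borel_measurable borel" and v0: "\<And>q. 0 \<le> v q"
    and v_swap: "\<And>q. v (snd q, fst q) = v q"
  shows "ring_energy v m n \<eta> (pVP_filling \<zeta>) \<le> ring_energy v m n \<eta> (pSP_filling \<zeta>)"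
proof -
  define S where "S \<Omega> q = v q * lindhard m n \<eta> (pSP_filling \<zeta>) \<Omega> q" for \<Omega> q
  define V where "V \<Omega> q = v q * lindhard m n \<eta> (pVP_filling \<zeta>) \<Omega> q" for \<Omega> q
  define w where "w \<Omega> = indicator {0..} \<Omega> / (2 * pi) ^ 3" for \<Omega> :: real
  have w0: "0 \<le> w \<Omega>" for \<Omega>
    by (simp add: w_def)
  have S0: "0 \<le> S \<Omega> q" for \<Omega> q
    unfolding S_def using \<zeta> by (intro mult_nonneg_nonneg v0 lindhard_nonneg m n \<eta>)
      (auto simp: pSP_filling_def)
  have V0: "0 \<le> V \<Omega> q" for \<Omega> q
    unfolding V_def using \<zeta> by (intro mult_nonneg_nonneg v0 lindhard_nonneg m n \<eta>)
      (auto simp: pVP_filling_def)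
  have S_avg: "S \<Omega> q = (V \<Omega> q + V \<Omega> (snd q, fst q)) / 2" for \<Omega> q
    unfolding S_def V_def lindhard_pSP_eq_average v_swap by (simp add: algebra_simps)
  have meas: "(\<lambda>(\<Omega>, q). w \<Omega> * (v q * lindhard m n \<eta> \<nu> \<Omega> q - ln (1 + v q * lindhard m n \<eta> \<nu> \<Omega> q)))
      \<in> borel_measurable (lborel \<Otimes>\<^sub>M lborel)" for \<nu>
    unfolding w_def case_prod_unfold by measurable
  have "(\<integral>\<Omega>. \<integral>q. w \<Omega> * (S \<Omega> q - ln (1 + S \<Omega> q)) \<partial>lborel \<partial>lborel)
      \<le> (\<integral>\<Omega>. \<integral>q. w \<Omega> * (V \<Omega> q - ln (1 + V \<Omega> q)) \<partial>lborel \<partial>lborel)"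
  proof (rule iterated_integral_mono_symmetrized[where T = "\<lambda>q. (snd q, fst q)" and c = 4])
    show "sigma_finite_measure (lborel :: (real \<times> real) measure)"
      by (rule sigma_finite_lborel)
    show "(\<lambda>(\<Omega>, q). w \<Omega> * (S \<Omega> q - ln (1 + S \<Omega> q))) \<in> borel_measurable (lborel \<Otimes>\<^sub>M lborel)"
      unfolding S_def by (rule meas)
    show "(\<lambda>(\<Omega>, q). w \<Omega> * (V \<Omega> q - ln (1 + V \<Omega> q))) \<in> borel_measurable (lborel \<Otimes>\<^sub>M lborel)"
      unfolding V_def by (rule meas)
    show "(\<lambda>q::real \<times> real. (snd q, fst q)) \<in> measurable lborel lborel"
      by (simp add: borel_prod[symmetric])
    show "distr lborel lborel (\<lambda>q::real \<times> real. (snd q, fst q)) = lborel"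
      by (rule distr_lborel_swap)
  next
    fix \<Omega> :: real and q :: "real \<times> real"
    show "0 \<le> w \<Omega> * (S \<Omega> q - ln (1 + S \<Omega> q))"
      by (intro mult_nonneg_nonneg w0 ln_defect_nonneg S0)
    show "0 \<le> w \<Omega> * (V \<Omega> q - ln (1 + V \<Omega> q))"
      by (intro mult_nonneg_nonneg w0 ln_defect_nonneg V0)
    let ?q = "(snd q, fst q)"
    have "w \<Omega> * (S \<Omega> q - ln (1 + S \<Omega> q))
        \<le> w \<Omega> * (((V \<Omega> q - ln (1 + V \<Omega> q)) + (V \<Omega> ?q - ln (1 + V \<Omega> ?q))) / 2)"
      unfolding S_avg by (intro mult_left_mono ln_defect_midpoint V0 w0)
    then show "w \<Omega> * (S \<Omega> q - ln (1 + S \<Omega> q))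
        \<le> (w \<Omega> * (V \<Omega> q - ln (1 + V \<Omega> q)) + w \<Omega> * (V \<Omega> ?q - ln (1 + V \<Omega> ?q))) / 2"
      by (simp add: algebra_simps add_divide_distrib)
    \<comment> \<open>The other half of the average is nonnegative. Doubling the argument then costs
      the factor 4, which is the choice of \<open>c\<close>.\<close>
    have "V \<Omega> q \<le> 2 * S \<Omega> q"
      using V0[of \<Omega> ?q] by (simp add: S_avg)
    then have "V \<Omega> q - ln (1 + V \<Omega> q) \<le> 2 * S \<Omega> q - ln (1 + 2 * S \<Omega> q)"
      by (intro ln_defect_mono V0)
    also have "\<dots> \<le> 4 * (S \<Omega> q - ln (1 + S \<Omega> q))"
      by (intro ln_defect_double S0)
    finally show "w \<Omega> * (V \<Omega> q - ln (1 + V \<Omega> q)) \<le> 4 * (w \<Omega> * (S \<Omega> q - ln (1 + S \<Omega> q)))"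
      using w0[of \<Omega>] by (simp only: mult.left_commute[of 4] mult_left_mono)
  qed
  then show ?thesis
    unfolding ring_energy_eq_iterated_integral S_def V_def w_def by (rule le_imp_neg_le)
qed

lemma E_pVP_le_E_pSP:
  assumes "0 < m" "0 \<le> n" "0 \<le> a\<^sub>B" "0 < \<eta>" "\<bar>\<zeta>\<bar> \<le> 1"
  shows "E_pVP m n a\<^sub>B \<eta> \<zeta> \<le> E_pSP m n a\<^sub>B \<eta> \<zeta>"
proof -
  have "ring_energy (coulomb m a\<^sub>B) m n \<eta> (pVP_filling \<zeta>)
      \<le> ring_energy (coulomb m a\<^sub>B) m n \<eta> (pSP_filling \<zeta>)"
  proof (rule ring_energy_pVP_le_pSP)
    show "coulomb m a\<^sub>B \<in> borel_measurable borel"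
      unfolding coulomb_def by measurable
  qed (use assms in \<open>auto simp: coulomb_def norm_prod_def add.commute\<close>)
  \<comment> \<open>Kinetic and exchange energy are symmetric in the flavors, and the two fillings
    are permutations of each other.\<close>
  moreover have "kinetic_energy m n (pVP_filling \<zeta>) = kinetic_energy m n (pSP_filling \<zeta>)"
    unfolding kinetic_energy_def sum_flavors by (simp add: pVP_filling_def pSP_filling_def)
  moreover have "exchange_energy m n a\<^sub>B \<eta> (pVP_filling \<zeta>) = exchange_energy m n a\<^sub>B \<eta> (pSP_filling \<zeta>)"
    unfolding exchange_energy_def sum_flavors by (simp add: pVP_filling_def pSP_filling_def)
  ultimately show ?thesis
    by (simp add: E_pVP_def E_pSP_def rpa_energy_def)
qed

lemma E_pVP_zero_eq_E_pSP_zero: "E_pVP m n a\<^sub>B \<eta> 0 = E_pSP m n a\<^sub>B \<eta> 0"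
proof -
  have "pVP_filling 0 = pSP_filling 0"
    by (auto simp: pVP_filling_def pSP_filling_def)
  then show ?thesis
    by (simp add: E_pVP_def E_pSP_def)
qed

section \<open>Second derivatives\<close>

text \<open>If \<open>D\<close> were negative, \<open>f'\<close> would be negative just to the right
  of \<open>x\<close>, and by the mean value theorem \<open>f\<close> would drop below
  \<open>f x\<close> there.\<close>

lemma deriv2_nonneg_at_local_min:
  fixes f f' :: "real \<Rightarrow> real"
  assumes f: "\<forall>\<^sub>F y in nhds x. (f has_real_derivative f' y) (at y)"
    and f': "(f' has_real_derivative D) (at x)" "f' x = 0"
    and min: "\<forall>\<^sub>F y in nhds x. f x \<le> f y"
  shows "0 \<le> D"
proof (rule ccontr)
  assume "\<not> 0 \<le> D"
  then obtain d where d: "d > 0" "\<And>h. 0 < h \<Longrightarrow> h < d \<Longrightarrow> f' (x + h) < 0"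
    using DERIV_neg_dec_right[OF f'(1)] f'(2) by auto
  obtain e where e: "e > 0" "\<And>y. dist y x < e \<Longrightarrow> (f has_real_derivative f' y) (at y) \<and> f x \<le> f y"
    using eventually_conj[OF f min] unfolding eventually_nhds_metric by auto
  define h where "h = min d e / 2"
  have h: "0 < h" "h < d" "h < e"
    using d(1) e(1) by (auto simp: h_def)
  obtain z where z: "x < z" "z < x + h" "f (x + h) - f x = (x + h - x) * f' z"
    using MVT2[of x "x + h" f f'] h e(2) by (auto simp: dist_real_def)
  have "f' z < 0"
    using d(2)[of "z - x"] z h by simp
  then have "f (x + h) < f x"
    using z(3) h(1) mult_pos_neg[of h "f' z"] by simp
  moreover have "f x \<le> f (x + h)"
    using e(2)[of "x + h"] h by (simp add: dist_real_def)
  ultimately show False by simp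
qed

text \<open>The difference \<open>g - f\<close> has a local minimum at the contact point
  \<open>x\<close>.\<close>

lemma deriv2_mono_at_contact:
  fixes f g :: "real \<Rightarrow> real"
  assumes f: "twice_differentiable_at f x" and g: "twice_differentiable_at g x"
    and eq: "f x = g x" "deriv f x = deriv g x" and le: "\<forall>\<^sub>F y in nhds x. f y \<le> g y"
  shows "deriv (deriv f) x \<le> deriv (deriv g) x"
proof -
  have "\<forall>\<^sub>F y in nhds x. f differentiable (at y) \<and> g differentiable (at y)"
    using f g by (auto simp: twice_differentiable_at_def eventually_conj_iff)
  then have "\<forall>\<^sub>F y in nhds x. ((\<lambda>y. g y - f y) has_real_derivative deriv g y - deriv f y) (at y)"
    by eventually_elim
      (auto intro!: DERIV_diff simp: DERIV_deriv_iff_real_differentiable)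
  moreover have "((\<lambda>y. deriv g y - deriv f y) has_real_derivative
      deriv (deriv g) x - deriv (deriv f) x) (at x)"
    using f g by (auto intro!: DERIV_diff
        simp: DERIV_deriv_iff_real_differentiable twice_differentiable_at_def)
  moreover have "\<forall>\<^sub>F y in nhds x. g x - f x \<le> g y - f y"
    using le by eventually_elim (simp add: eq)
  ultimately have "0 \<le> deriv (deriv g) x - deriv (deriv f) x"
    using eq(2) by (intro deriv2_nonneg_at_local_min[where f = "\<lambda>y. g y - f y" and x = x
          and f' = "\<lambda>y. deriv g y - deriv f y"]) auto
  then show ?thesis by simp
qed

theorem mainTheorem3:
  fixes m n\<^sub>e\<^sub>l a\<^sub>B \<eta> :: real
  assumes "m > 0" and "n\<^sub>e\<^sub>l > 0" and "a\<^sub>B > 0" and "\<eta> > 0" and "\<eta> \<noteq> 1"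
    and "twice_differentiable_at (E_pVP m n\<^sub>e\<^sub>l a\<^sub>B \<eta>) 0"
    and "deriv (E_pVP m n\<^sub>e\<^sub>l a\<^sub>B \<eta>) 0 = 0"
    and "deriv (deriv (E_pVP m n\<^sub>e\<^sub>l a\<^sub>B \<eta>)) 0 > 0"
    and "twice_differentiable_at (E_pSP m n\<^sub>e\<^sub>l a\<^sub>B \<eta>) 0"
    and "deriv (E_pSP m n\<^sub>e\<^sub>l a\<^sub>B \<eta>) 0 = 0"
    and "deriv (deriv (E_pSP m n\<^sub>e\<^sub>l a\<^sub>B \<eta>)) 0 > 0"
  shows "chi_s m n\<^sub>e\<^sub>l a\<^sub>B \<eta> \<le> chi_v m n\<^sub>e\<^sub>l a\<^sub>B \<eta>"
proof -
  have "\<forall>\<^sub>F \<zeta> in nhds 0. E_pVP m n\<^sub>e\<^sub>l a\<^sub>B \<eta> \<zeta> \<le> E_pSP m n\<^sub>e\<^sub>l a\<^sub>B \<eta> \<zeta>"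
    unfolding eventually_nhds_metric
    using assms(1-4) by (intro exI[of _ 1]) (auto intro!: E_pVP_le_E_pSP)
  then have "deriv (deriv (E_pVP m n\<^sub>e\<^sub>l a\<^sub>B \<eta>)) 0 \<le> deriv (deriv (E_pSP m n\<^sub>e\<^sub>l a\<^sub>B \<eta>)) 0"
    using assms by (intro deriv2_mono_at_contact E_pVP_zero_eq_E_pSP_zero) auto
  \<comment> \<open>Inversion reverses the order because the smaller second derivative, that of
    \<open>E_pVP\<close>, is positive.\<close>
  then show ?thesis
    unfolding chi_s_def chi_v_def using assms(8) by (intro le_imp_inverse_le)
qed

end
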